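(* Let $\mathbf{x}_0\in\mathbb{R}^d$ be an input with ground-truth label $y_0\in[C]$, let $r>0$, and let $\mathcal{M}_{\mathrm{MME}}$ be the Max-Margin Ensemble over two base models $\{F_1,F_2\}$ with confidence functions $f_1,f_2$. Suppose $\mathcal{M}_{\mathrm{MME}}(\mathbf{x}_0)=y_0$ and both $F_1$ and $F_2$ are $\beta$-smooth. (Sufficient condition) If for all $y_1,y_2\in[C]$ with $y_1\ne y_0$ and $y_2\neq y_0$, $$\|\nabla_{\mathbf{x}} f_1^{y_0/y_1}(\mathbf{x}_0)+\nabla_{\mathbf{x}} f_2^{y_0/y_2}(\mathbf{x}_0)\|_2\le\frac1r\big(f_1^{y_0/y_1}(\mathbf{x}_0)+f_2^{y_0/y_2}(\mathbf{x}_0)\big)-2\beta r,$$ then $\mathcal{M}_{\mathrm{MME}}$ is $r$-robust at $\mathbf{x}_0$. (Necessary condition) Suppose that for every $\mathbf{x}\in\{\mathbf{x}_0+\boldsymbol\delta:\|\boldsymbol\delta\|_2\le r\}$ and every $i\in\{1,2\}$, either $F_i(\mathbf{x})=y_0$ or $F_i^{(2)}(\mathbf{x})=y_0$. If $\mathcal{M}_{\mathrm{MME}}$ is $r$-robust at $\mathbf{x}_0$, then for all $y_1,y_2\in[C]$ with $y_1\ne y_0$ and $y_2\neq y_0$, $$\|\nabla_{\mathbf{x}} f_1^{y_0/y_1}(\mathbf{x}_0)+\nabla_{\mathbf{x}} f_2^{y_0/y_2}(\mathbf{x}_0)\|_2\le\frac1r\big(f_1^{y_0/y_1}(\mathbf{x}_0)+f_2^{y_0/y_2}(\mathbf{x}_0)\big)+2\beta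 r.$$
   Context: Classification with $C$ classes, $[C]=\{1,\dots,C\}$. A model has a confidence function $f:\mathbb{R}^d\to\Delta^C=\{\mathbf{p}\in\mathbb{R}^C_{\ge0}:\|\mathbf{p}\|_1=1\}$, prediction $F(\mathbf{x})=\arg\max_{i\in[C]}f(\mathbf{x})_i$ and runner-up prediction $F^{(2)}(\mathbf{x})=\arg\max_{i\in[C]:i\ne F(\mathbf{x})}f(\mathbf{x})_i$ (no tie-breaking rule is specified). Confidence margin: $f^{y_1/y_2}(\mathbf{x}):=f(\mathbf{x})_{y_1}-f(\mathbf{x})_{y_2}$. $r$-robustness: a prediction function $F:\mathbb{R}^d\to[C]$ is $r$-robust at $\mathbf{x}_0$ if $F(\mathbf{x})=F(\mathbf{x}_0)$ for all $\mathbf{x}\in\{\mathbf{x}_0+\boldsymbol\delta:\|\boldsymbol\delta\|_2<r\}$. Max-Margin Ensemble over $\{F_i\}_{i=1}^N$: $\mathcal{M}_{\mathrm{MME}}(\mathbf{x}):=F_c(\mathbf{x})$ where $c=\arg\max_{i\in[N]}\big(f_i(\mathbf{x})_{F_i(\mathbf{x})}-f_i(\mathbf{x})_{F_i^{(2)}(\mathbf{x})}\big)$. $\beta$-smoothness: a differentiable $f:\mathbb{R}^d\to\mathbb{R}^C$ is $\beta$-smooth if $\|\nabla f(\mathbf{x}_1)_j-\nabla f(\mathbf{x}_2)_j\|_2\le\beta\|\mathbf{x}_1-\mathbf{x}_2\|_2$ for all $\mathbf{x}_1,\mathbf{x}_2\in\mathbb{R}^d$ and $j\in[C]$. A model $F$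 is called $\beta$-smooth if its confidence function $f$ is $\beta$-smooth. *)

theory Defs
  imports "HOL-Analysis.Analysis"
begin

text \<open>
  The classes are the elements of a finite type \<open>'c\<close> and inputs are vectors in \<open>real ^ 'd\<close>,
  so a confidence function has type \<open>real ^ 'd \<Rightarrow> real ^ 'c\<close>.
\<close>

definition prob_simplex :: "(real ^ 'c) set" where
  "prob_simplex = {p. (\<forall>i. 0 \<le> p $ i) \<and> (\<Sum>i\<in>UNIV. \<bar>p $ i\<bar>) = 1}"

text \<open>
  An argmax is only determined up to ties. An \<open>argmax_rule\<close> is any operator that picks a
  maximiser of the scores \<open>s\<close> over \<open>A\<close>, where the pick is a function of \<open>A\<close> and of the scores on
  \<open>A\<close> alone. The notions below are parametrised by such operators.
\<close>

definition argmax_rule :: "(('i \<Rightarrow> real) \<Rightarrow> 'i set \<Rightarrow> 'i) \<Rightarrow> bool" where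
  "argmax_rule am \<longleftrightarrow> (\<forall>s A. finite A \<and> A \<noteq> {} \<longrightarrow>
     is_arg_max s (\<lambda>i. i \<in> A) (am s A) \<and>
     (\<forall>t. (\<forall>i\<in>A. t i = s i) \<longrightarrow> am t A = am s A))"

lemma argmax_rule_arg_max_on: "argmax_rule arg_max_on"
  unfolding argmax_rule_def
proof (intro allI impI conjI)
  fix s :: "'i \<Rightarrow> real" and A :: "'i set"
  assume A: "finite A \<and> A \<noteq> {}"
  then have fin: "finite (s ` A)" and ne: "s ` A \<noteq> {}" by auto
  obtain m where "m \<in> A" and m: "s m = Max (s ` A)"
    using Max_in[OF fin ne] by auto
  then have "is_arg_max s (\<lambda>i. i \<in> A) m"
    using fin by (auto simp: is_arg_max_linorder)
  then show "is_arg_max s (\<lambda>i. i \<in> A) (arg_max_on s A)"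
    unfolding arg_max_on_def arg_max_def by (rule someI)
  fix t :: "'i \<Rightarrow> real"
  assume "\<forall>i\<in>A. t i = s i"
  then have "is_arg_max t (\<lambda>i. i \<in> A) = is_arg_max s (\<lambda>i. i \<in> A)"
    by (auto simp: is_arg_max_linorder fun_eq_iff)
  then show "arg_max_on t A = arg_max_on s A"
    unfolding arg_max_on_def arg_max_def by simp
qed

definition prediction ::
  "(('c \<Rightarrow> real) \<Rightarrow> 'c set \<Rightarrow> 'c) \<Rightarrow> (real ^ 'd \<Rightarrow> real ^ 'c) \<Rightarrow> real ^ 'd \<Rightarrow> 'c" where
  "prediction am f x = am (\<lambda>i. f x $ i) UNIV"

definition runner_up ::
  "(('c \<Rightarrow> real) \<Rightarrow> 'c set \<Rightarrow> 'c) \<Rightarrow> (real ^ 'd \<Rightarrow> real ^ 'c) \<Rightarrow> real ^ 'd \<Rightarrow> 'c" where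
  "runner_up am f x = am (\<lambda>i. f x $ i) {i. i \<noteq> prediction am f x}"

definition conf_margin :: "(real ^ 'd \<Rightarrow> real ^ 'c) \<Rightarrow> 'c \<Rightarrow> 'c \<Rightarrow> real ^ 'd \<Rightarrow> real" where
  "conf_margin f y1 y2 x = f x $ y1 - f x $ y2"

definition robust_at :: "real \<Rightarrow> (real ^ 'd \<Rightarrow> 'c) \<Rightarrow> real ^ 'd \<Rightarrow> bool" where
  "robust_at r F x0 \<longleftrightarrow> (\<forall>\<delta>. norm \<delta> < r \<longrightarrow> F (x0 + \<delta>) = F x0)"

text \<open>
  The base models are \<open>f 1, \<dots>, f N\<close>; \<open>am\<close> selects classes and \<open>bm\<close> selects base models.
\<close>

definition max_margin_ensemble ::
  "(('c \<Rightarrow> real) \<Rightarrow> 'c set \<Rightarrow> 'c) \<Rightarrow> ((nat \<Rightarrow> real) \<Rightarrow> nat set \<Rightarrow> nat) \<Rightarrow>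
   nat \<Rightarrow> (nat \<Rightarrow> real ^ 'd \<Rightarrow> real ^ 'c) \<Rightarrow> real ^ 'd \<Rightarrow> 'c" where
  "max_margin_ensemble am bm N f x =
     (let c = bm (\<lambda>i. f i x $ prediction am (f i) x - f i x $ runner_up am (f i) x) {1..N}
      in prediction am (f c) x)"

definition gradient :: "('a::real_inner \<Rightarrow> real) \<Rightarrow> 'a \<Rightarrow> 'a" where
  "gradient g x = (THE D. GDERIV g x :> D)"

lemma gradient_eqI:
  assumes "GDERIV g x :> D"
  shows "gradient g x = D"
  unfolding gradient_def
proof (rule the_equality)
  show "GDERIV g x :> D" by fact
  fix D'
  assume "GDERIV g x :> D'"
  with assms have "(\<lambda>h. inner h D') = (\<lambda>h. inner h D)"
    unfolding gderiv_def by (rule has_derivative_unique[rotated])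
  then have "inner (D' - D) D' = inner (D' - D) D" by (rule fun_cong)
  then have "inner (D' - D) (D' - D) = 0" by (simp add: inner_diff_right)
  then show "D' = D" by simp
qed

definition smooth :: "real \<Rightarrow> (real ^ 'd \<Rightarrow> real ^ 'c) \<Rightarrow> bool" where
  "smooth \<beta> f \<longleftrightarrow> f differentiable_on UNIV \<and>
     (\<forall>x1 x2 j. norm (gradient (\<lambda>x. f x $ j) x1 - gradient (\<lambda>x. f x $ j) x2)
                  \<le> \<beta> * norm (x1 - x2))"

end

theory Submission
  imports Defs
begin

text \<open>
  The ensemble predicts \<open>y0\<close> at \<open>x\<close> essentially iff every pair of margins satisfies
  \<open>conf_margin (f 1) y0 y1 x + conf_margin (f 2) y0 y2 x \<ge> 0\<close>. Each such sum has a
  \<open>4 * \<beta>\<close>-Lipschitz gradient, so on the ball of radius \<open>r\<close> it differs from its linearisation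
  at \<open>x0\<close> by at most \<open>2 * \<beta> * r\<^sup>2\<close>; the extreme values of the linearisation give both
  conditions. Ties can survive the sufficient condition only for \<open>\<beta> = 0\<close>, and then the
  confidences are affine and bounded, hence constant.
\<close>

section \<open>Argmax rules, top margins, and the choice between two models\<close>

lemma argmax_rule_in:
  assumes "argmax_rule am" "finite A" "A \<noteq> {}"
  shows "am s A \<in> A"
  using assms unfolding argmax_rule_def is_arg_max_def by blast

lemma argmax_rule_ge:
  assumes "argmax_rule am" "finite A" "i \<in> A"
  shows "s i \<le> s (am s A)"
proof -
  have "is_arg_max s (\<lambda>i. i \<in> A) (am s A)"
    using assms unfolding argmax_rule_def by blast
  with assms(3) show ?thesis by (simp add: is_arg_max_linorder)
qed

lemma argmax_rule_cong:
  assumes "argmax_rule am" "finite A" "A \<noteq> {}" "\<And>i. i \<in> A \<Longrightarrow> t i = s i"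
  shows "am t A = am s A"
  using assms unfolding argmax_rule_def by blast

lemma prediction_ge:
  assumes "argmax_rule am"
  shows "f x $ i \<le> f x $ prediction am f x"
  unfolding prediction_def using argmax_rule_ge[OF assms, of UNIV i "\<lambda>i. f x $ i"] by simp

lemma runner_up_ge:
  assumes "argmax_rule am" "i \<noteq> prediction am f x"
  shows "f x $ i \<le> f x $ runner_up am f x"
  unfolding runner_up_def
  using argmax_rule_ge[OF assms(1), of "{i. i \<noteq> prediction am f x}" i "\<lambda>i. f x $ i"] assms(2)
  by simp

text \<open>The witness \<open>i\<close> guarantees a second class: \<open>argmax_rule\<close> says
  nothing about the pick from an empty set.\<close>

lemma runner_up_neq_prediction:
  assumes "argmax_rule am" "i \<noteq> prediction am f x"
  shows "runner_up am f x \<noteq> prediction am f x"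
  unfolding runner_up_def
  using argmax_rule_in[OF assms(1), of "{i. i \<noteq> prediction am f x}" "\<lambda>i. f x $ i"] assms(2)
  by auto

abbreviation top_margin ::
  "(('c \<Rightarrow> real) \<Rightarrow> 'c set \<Rightarrow> 'c) \<Rightarrow> (real ^ 'd \<Rightarrow> real ^ 'c) \<Rightarrow> real ^ 'd \<Rightarrow> real" where
  "top_margin am f x \<equiv> f x $ prediction am f x - f x $ runner_up am f x"

text \<open>Here \<open>p\<close> plays the selected model. If \<open>p\<close> rejects
  \<open>y0\<close>, then \<open>q\<close> must predict it, since otherwise both margins against the
  predicted classes are nonpositive. But then \<open>y0\<close> trails in \<open>p\<close> by at
  least the top margin of \<open>p\<close>, and leads in \<open>q\<close> over the runner-up by only
  the top margin of \<open>q\<close>, so these two margins have a nonpositive sum.\<close>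

lemma prediction_eqI_margin_sum_pos:
  assumes am: "argmax_rule am" and le: "top_margin am q x \<le> top_margin am p x"
    and pos: "\<And>y1 y2. \<lbrakk>y1 \<noteq> y0; y2 \<noteq> y0\<rbrakk> \<Longrightarrow> 0 < conf_margin p y0 y1 x + conf_margin q y0 y2 x"
  shows "prediction am p x = y0"
proof (rule ccontr)
  assume P: "prediction am p x \<noteq> y0"
  have p: "p x $ y0 \<le> p x $ runner_up am p x" "p x $ y0 \<le> p x $ prediction am p x"
    using runner_up_ge[OF am, of y0 p x] prediction_ge[OF am, of p x y0] P by auto
  have Q: "prediction am q x = y0"
  proof (rule ccontr)
    assume "prediction am q x \<noteq> y0"
    with pos[OF P this] p prediction_ge[OF am, of q x y0] show False
      by (simp add: conf_margin_def)
  qed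
  have "runner_up am q x \<noteq> y0"
    using runner_up_neq_prediction[OF am, of "prediction am p x" q x] P Q by simp
  from pos[OF P this] p Q le show False
    by (simp add: conf_margin_def)
qed

text \<open>If \<open>q\<close> predicts \<open>y0\<close>, both summands are nonnegative. If
  \<open>y0\<close> is the runner-up of \<open>q\<close>, it trails there by at most the top margin
  of \<open>q\<close>, which the lead of \<open>y0\<close> over \<open>y1\<close> in
  \<open>p\<close> compensates.\<close>

lemma margin_sum_nonneg:
  assumes am: "argmax_rule am" and le: "top_margin am q x \<le> top_margin am p x"
    and P: "prediction am p x = y0"
    and Q: "prediction am q x = y0 \<or> runner_up am q x = y0"
    and y: "y1 \<noteq> y0" "y2 \<noteq> y0"
  shows "0 \<le> conf_margin p y0 y1 x + conf_margin q y0 y2 x"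
proof -
  have p: "p x $ y1 \<le> p x $ runner_up am p x" "p x $ y1 \<le> p x $ y0"
    using runner_up_ge[OF am, of y1 p x] prediction_ge[OF am, of p x y1] P y by auto
  have "q x $ y2 \<le> q x $ prediction am q x"
    by (rule prediction_ge[OF am])
  with p le P Q show ?thesis
    by (auto simp: conf_margin_def)
qed

text \<open>Names the selected model \<open>c\<close> and the other one \<open>d\<close>, so that
  the two possible selections can be treated by one symmetric argument.\<close>

lemma max_margin_ensemble_2E:
  assumes "argmax_rule bm"
  obtains c d where "(c, d) \<in> {(1, 2), (2, 1)}"
    and "max_margin_ensemble am bm 2 f x = prediction am (f c) x"
    and "top_margin am (f d) x \<le> top_margin am (f c) x"
proof -
  let ?c = "bm (\<lambda>i. top_margin am (f i) x) {1..2}"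
  have mme: "max_margin_ensemble am bm 2 f x = prediction am (f ?c) x"
    by (simp add: max_margin_ensemble_def Let_def)
  have "?c \<in> {1..2}"
    by (rule argmax_rule_in[OF assms]) auto
  then have c: "?c = 1 \<or> ?c = 2" by auto
  have ge: "top_margin am (f i) x \<le> top_margin am (f ?c) x" if "i \<in> {1..2}" for i
    using argmax_rule_ge[OF assms, of "{1..2}" i "\<lambda>i. top_margin am (f i) x"] that by simp
  show thesis
    using c
  proof
    assume "?c = 1"
    then show thesis using that[of 1 2] mme ge[of 2] by simp
  next
    assume "?c = 2"
    then show thesis using that[of 2 1] mme ge[of 1] by simp
  qed
qed

section \<open>Gradients and quadratic bounds under a Lipschitz gradient\<close>

lemma GDERIV_gradient:
  fixes g :: "'a::euclidean_space \<Rightarrow> real"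
  assumes "g differentiable (at x)"
  shows "GDERIV g x :> gradient g x"
proof -
  obtain g' where g': "(g has_derivative g') (at x)"
    using assms unfolding differentiable_def by blast
  have "linear g'"
    using g' by (rule has_derivative_linear)
  \<comment> \<open>Riesz representation: the vector representing the functional \<open>g'\<close>
    is the image of 1 under its adjoint.\<close>
  then have "g' = (\<lambda>h. h \<bullet> adjoint g' 1)"
    by (simp add: adjoint_works)
  with g' have "GDERIV g x :> adjoint g' 1"
    unfolding gderiv_def by simp
  then show ?thesis
    using gradient_eqI by metis
qed

text \<open>The descent lemma. Along the segment from \<open>x\<close> to \<open>x + h\<close>, the
  slope of \<open>g\<close> exceeds its initial value by at most
  \<open>L * t * (norm h)\<^sup>2\<close>, by Cauchy-Schwarz; subtracting the integrated excess
  leaves a nonincreasing function \<phi>.\<close>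

lemma Lipschitz_gradient_upper_bound:
  fixes g :: "'a::real_inner \<Rightarrow> real"
  assumes g: "\<And>x. GDERIV g x :> G x"
    and L: "\<And>x y. norm (G x - G y) \<le> L * norm (x - y)"
  shows "g (x + h) \<le> g x + G x \<bullet> h + L / 2 * (norm h)\<^sup>2"
proof -
  define \<phi> where "\<phi> t = g (x + t *\<^sub>R h) - t * (G x \<bullet> h) - L / 2 * t\<^sup>2 * (norm h)\<^sup>2" for t
  have "\<phi> 1 \<le> \<phi> 0"
  proof (rule DERIV_nonpos_imp_nonincreasing[of 0 1 \<phi>])
    fix t :: real
    assume t: "0 \<le> t" "t \<le> 1"
    let ?D = "G (x + t *\<^sub>R h) \<bullet> h - G x \<bullet> h - L * t * (norm h)\<^sup>2"
    have g': "(g has_derivative (\<lambda>k. k \<bullet> G (x + t *\<^sub>R h))) (at (x + t *\<^sub>R h))"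
      using g unfolding gderiv_def .
    have "((\<lambda>t. x + t *\<^sub>R h) has_derivative (\<lambda>s. s *\<^sub>R h)) (at t)"
      by (auto intro!: derivative_eq_intros)
    from diff_chain_at[OF this g']
    have "((\<lambda>t. g (x + t *\<^sub>R h)) has_real_derivative G (x + t *\<^sub>R h) \<bullet> h) (at t)"
      by (simp add: has_field_derivative_def o_def inner_commute mult_commute_abs)
    then have *: "DERIV \<phi> t :> ?D"
      unfolding \<phi>_def by (auto intro!: derivative_eq_intros simp: power2_eq_square)
    have "(G (x + t *\<^sub>R h) - G x) \<bullet> h \<le> L * norm (t *\<^sub>R h) * norm h"
      using norm_cauchy_schwarz[of "G (x + t *\<^sub>R h) - G x" h]
        mult_right_mono[OF L[of "x + t *\<^sub>R h" x] norm_ge_zero[of h]] by simp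
    then have "?D \<le> 0"
      using t by (simp add: inner_diff_left power2_eq_square mult_ac)
    with * show "\<exists>y. DERIV \<phi> t :> y \<and> y \<le> 0" by blast
  qed simp
  then show ?thesis by (simp add: \<phi>_def)
qed

lemma GDERIV_uminus:
  assumes "GDERIV g x :> D"
  shows "GDERIV (\<lambda>x. - g x) x :> - D"
  using has_derivative_minus[OF assms[unfolded gderiv_def]] by (simp add: gderiv_def)

lemma Lipschitz_gradient_lower_bound:
  fixes g :: "'a::real_inner \<Rightarrow> real"
  assumes g: "\<And>x. GDERIV g x :> G x"
    and L: "\<And>x y. norm (G x - G y) \<le> L * norm (x - y)"
  shows "g x + G x \<bullet> h - L / 2 * (norm h)\<^sup>2 \<le> g (x + h)"
proof -
  have "norm (- G x - - G y) \<le> L * norm (x - y)" for x y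
    using L[of x y] by (simp add: norm_minus_commute)
  from Lipschitz_gradient_upper_bound[OF GDERIV_uminus[OF g] this, of x h]
  show ?thesis by simp
qed

text \<open>For \<open>L = 0\<close> the upper and lower bounds coincide and make \<open>g\<close>
  affine, and a bounded affine function has zero slope.\<close>

lemma bounded_constant_gradient_imp_constant:
  fixes g :: "'a::real_inner \<Rightarrow> real"
  assumes g: "\<And>x. GDERIV g x :> D" and b: "\<And>x. \<bar>g x\<bar> \<le> B"
  shows "g x = g y"
proof -
  have affine: "g (x + h) = g x + D \<bullet> h" for x h
    using Lipschitz_gradient_upper_bound[OF g, of 0 x h]
      Lipschitz_gradient_lower_bound[OF g, of 0 x h] by simp
  have "D = 0"
  proof (rule ccontr)
    assume "D \<noteq> 0"
    \<comment> \<open>The step along \<open>D\<close> is scaled so that \<open>g\<close> rises by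
      \<open>2 * B + 1\<close>, more than the length of the interval from \<open>-B\<close> to
      \<open>B\<close>.\<close>
    then have "g (0 + ((2 * B + 1) / (D \<bullet> D)) *\<^sub>R D) = g 0 + (2 * B + 1)"
      by (subst affine) simp
    with b[of 0] b[of "0 + ((2 * B + 1) / (D \<bullet> D)) *\<^sub>R D"] show False by linarith
  qed
  with affine[of y "x - y"] show ?thesis by simp
qed

section \<open>Smooth confidence functions and their margins\<close>

lemma smooth_GDERIV:
  assumes "smooth \<beta> f"
  shows "GDERIV (\<lambda>x. f x $ j) x :> gradient (\<lambda>x. f x $ j) x"
proof (rule GDERIV_gradient)
  have "f differentiable (at x)"
    using assms by (simp add: smooth_def differentiable_on_def)
  then show "(\<lambda>x. f x $ j) differentiable (at x)"
    unfolding differentiable_def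
    using bounded_linear.has_derivative[OF bounded_linear_vec_nth] by blast
qed

lemma smooth_nonneg:
  fixes f :: "real ^ 'd \<Rightarrow> real ^ 'c"
  assumes "smooth \<beta> f"
  shows "0 \<le> \<beta>"
proof -
  \<comment> \<open>Two points at distance 1 turn the Lipschitz inequality into a bound on \<beta>
    itself; any coordinate axis serves.\<close>
  have "0 \<le> \<beta> * norm (axis undefined 1 - 0 :: real ^ 'd)"
    using assms norm_ge_zero order_trans unfolding smooth_def by blast
  then show ?thesis by (simp add: norm_axis_1)
qed

lemma smooth_zero_prob_simplex_const:
  fixes f :: "real ^ 'd \<Rightarrow> real ^ 'c"
  assumes "smooth 0 f" and simplex: "\<And>x. f x \<in> prob_simplex"
  shows "f x = f y"
proof (rule vec_eq_iff[THEN iffD2], rule allI)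
  fix j
  have grad: "gradient (\<lambda>x. f x $ j) z = gradient (\<lambda>x. f x $ j) 0" for z
    using assms(1) unfolding smooth_def by (metis eq_iff_diff_eq_0 mult_zero_left norm_le_zero_iff)
  then have "GDERIV (\<lambda>x. f x $ j) z :> gradient (\<lambda>x. f x $ j) 0" for z
    using smooth_GDERIV[OF assms(1), of j z] by (simp only: grad[of z])
  moreover have "\<bar>f z $ j\<bar> \<le> 1" for z
  proof -
    have "\<bar>f z $ j\<bar> \<le> (\<Sum>i\<in>UNIV. \<bar>f z $ i\<bar>)"
      by (rule member_le_sum) auto
    also have "\<dots> = 1"
      using simplex[of z] unfolding prob_simplex_def by blast
    finally show ?thesis .
  qed
  ultimately show "f x $ j = f y $ j"
    by (rule bounded_constant_gradient_imp_constant)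
qed

lemma smooth_GDERIV_conf_margin:
  assumes "smooth \<beta> f"
  shows "GDERIV (conf_margin f y1 y2) x :> gradient (conf_margin f y1 y2) x"
    and "norm (gradient (conf_margin f y1 y2) x - gradient (conf_margin f y1 y2) z)
           \<le> 2 * \<beta> * norm (x - z)"
proof -
  let ?G = "\<lambda>j. gradient (\<lambda>x. f x $ j)"
  have D: "GDERIV (conf_margin f y1 y2) x :> ?G y1 x - ?G y2 x" for x
    unfolding conf_margin_def[abs_def] by (intro GDERIV_diff smooth_GDERIV[OF assms])
  have eq: "gradient (conf_margin f y1 y2) x = ?G y1 x - ?G y2 x" for x
    by (rule gradient_eqI[OF D])
  show "GDERIV (conf_margin f y1 y2) x :> gradient (conf_margin f y1 y2) x"
    using D by (simp add: eq)
  have "norm (?G j x - ?G j z) \<le> \<beta> * norm (x - z)" for j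
    using assms by (simp add: smooth_def)
  from this[of y1] this[of y2]
  have "norm ((?G y1 x - ?G y1 z) - (?G y2 x - ?G y2 z)) \<le> 2 * \<beta> * norm (x - z)"
    using norm_triangle_ineq4[of "?G y1 x - ?G y1 z" "?G y2 x - ?G y2 z"] by simp
  then show "norm (gradient (conf_margin f y1 y2) x - gradient (conf_margin f y1 y2) z)
           \<le> 2 * \<beta> * norm (x - z)"
    by (simp add: eq algebra_simps)
qed

text \<open>Four class scores enter the sum, each with a \<beta>-Lipschitz gradient. This gives the
  Lipschitz constant \<open>4 * \<beta>\<close>, which the quadratic bounds halve.\<close>

lemma margin_sum_bounds:
  fixes p q :: "real ^ 'd \<Rightarrow> real ^ 'c" and y0 y1 y2 :: 'c
  assumes "smooth \<beta> p" "smooth \<beta> q"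
  defines "g \<equiv> \<lambda>x. conf_margin p y0 y1 x + conf_margin q y0 y2 x"
    and "G \<equiv> \<lambda>x. gradient (conf_margin p y0 y1) x + gradient (conf_margin q y0 y2) x"
  shows "g (x + h) \<le> g x + G x \<bullet> h + 2 * \<beta> * (norm h)\<^sup>2"
    and "g x + G x \<bullet> h - 2 * \<beta> * (norm h)\<^sup>2 \<le> g (x + h)"
proof -
  have D: "GDERIV g x :> G x" for x
    unfolding g_def G_def by (intro GDERIV_add smooth_GDERIV_conf_margin(1)[OF assms(1)]
        smooth_GDERIV_conf_margin(1)[OF assms(2)])
  have L: "norm (G x - G z) \<le> (4 * \<beta>) * norm (x - z)" for x z
    using norm_triangle_mono[OF smooth_GDERIV_conf_margin(2)[OF assms(1), of y0 y1 x z]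
        smooth_GDERIV_conf_margin(2)[OF assms(2), of y0 y2 x z]]
    by (simp add: G_def algebra_simps)
  show "g (x + h) \<le> g x + G x \<bullet> h + 2 * \<beta> * (norm h)\<^sup>2"
    using Lipschitz_gradient_upper_bound[OF D L, of x h] by simp
  show "g x + G x \<bullet> h - 2 * \<beta> * (norm h)\<^sup>2 \<le> g (x + h)"
    using Lipschitz_gradient_lower_bound[OF D L, of x h] by simp
qed

theorem theorem3:
  fixes f :: "nat \<Rightarrow> real ^ 'd \<Rightarrow> real ^ 'c"
    and am :: "('c \<Rightarrow> real) \<Rightarrow> 'c set \<Rightarrow> 'c"
    and bm :: "(nat \<Rightarrow> real) \<Rightarrow> nat set \<Rightarrow> nat"
    and x0 :: "real ^ 'd" and y0 :: 'c and r \<beta> :: real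
  assumes "argmax_rule am" and "argmax_rule bm"
    and "\<And>i x. i \<in> {1, 2} \<Longrightarrow> f i x \<in> prob_simplex"
    and "r > 0"
    and "max_margin_ensemble am bm 2 f x0 = y0"
    and "smooth \<beta> (f 1)" and "smooth \<beta> (f 2)"
  shows "((\<forall>y1 y2. y1 \<noteq> y0 \<and> y2 \<noteq> y0 \<longrightarrow>
             norm (gradient (conf_margin (f 1) y0 y1) x0 + gradient (conf_margin (f 2) y0 y2) x0)
               \<le> 1 / r * (conf_margin (f 1) y0 y1 x0 + conf_margin (f 2) y0 y2 x0) - 2 * \<beta> * r)
           \<longrightarrow> robust_at r (max_margin_ensemble am bm 2 f) x0)
       \<and> ((\<forall>\<delta>. norm \<delta> \<le> r \<longrightarrow> (\<forall>i\<in>{1, 2}.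
              prediction am (f i) (x0 + \<delta>) = y0 \<or> runner_up am (f i) (x0 + \<delta>) = y0))
           \<longrightarrow> robust_at r (max_margin_ensemble am bm 2 f) x0
           \<longrightarrow> (\<forall>y1 y2. y1 \<noteq> y0 \<and> y2 \<noteq> y0 \<longrightarrow>
                 norm (gradient (conf_margin (f 1) y0 y1) x0 + gradient (conf_margin (f 2) y0 y2) x0)
                   \<le> 1 / r * (conf_margin (f 1) y0 y1 x0 + conf_margin (f 2) y0 y2 x0) + 2 * \<beta> * r))"
proof (intro conjI impI)
  let ?M = "max_margin_ensemble am bm 2 f"
  let ?g = "\<lambda>y1 y2 x. conf_margin (f 1) y0 y1 x + conf_margin (f 2) y0 y2 x"
  let ?G = "\<lambda>y1 y2. gradient (conf_margin (f 1) y0 y1) x0 + gradient (conf_margin (f 2) y0 y2) x0"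
  have \<beta>: "0 \<le> \<beta>" by (rule smooth_nonneg) fact
  note bounds = margin_sum_bounds[OF \<open>smooth \<beta> (f 1)\<close> \<open>smooth \<beta> (f 2)\<close>]
  {
    assume suff: "\<forall>y1 y2. y1 \<noteq> y0 \<and> y2 \<noteq> y0 \<longrightarrow>
      norm (?G y1 y2) \<le> 1 / r * ?g y1 y2 x0 - 2 * \<beta> * r"
    show "robust_at r ?M x0"
    proof (cases "\<beta> = 0")
      case True
      have const: "f i x = f i x0" if "i \<in> {1, 2}" for i x
        using assms(6,7) that True
        by (intro smooth_zero_prob_simplex_const assms(3)) auto
      have margins: "top_margin am (f i) x = top_margin am (f i) x0"
        and pred: "prediction am (f i) x = prediction am (f i) x0" if "i \<in> {1, 2}" for i x
        using const[OF that, of x] by (simp_all add: prediction_def runner_up_def)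
      have "?M x = ?M x0" for x
      proof -
        \<comment> \<open>Only the scores of models 1 and 2 are known to be constant. An argmax rule
          depends on the scores inside the index set alone, so even ties are broken alike at
          \<open>x\<close> and \<open>x0\<close>.\<close>
        have "bm (\<lambda>i. top_margin am (f i) x) {1..2} = bm (\<lambda>i. top_margin am (f i) x0) {1..2}"
          by (rule argmax_rule_cong[OF \<open>argmax_rule bm\<close>]) (auto intro!: margins)
        moreover have "bm (\<lambda>i. top_margin am (f i) x0) {1..2} \<in> {1..2}"
          by (rule argmax_rule_in[OF \<open>argmax_rule bm\<close>]) auto
        then have "bm (\<lambda>i. top_margin am (f i) x0) {1..2} \<in> {1, 2}" by auto
        ultimately show ?thesis
          using pred[of _ x] unfolding max_margin_ensemble_def Let_def by simp
      qed
      then show ?thesis by (simp add: robust_at_def)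
    next
      case False
      \<comment> \<open>The hypothesis times \<open>r\<close> covers the largest linear loss,
        \<open>r * norm (?G y1 y2)\<close>, and a quadratic loss of
        \<open>2 * \<beta> * r\<^sup>2\<close>. The actual quadratic loss is strictly smaller inside
        the open ball because \<beta> is positive, which excludes ties.\<close>
      have pos: "0 < ?g y1 y2 (x0 + \<delta>)" if "norm \<delta> < r" "y1 \<noteq> y0" "y2 \<noteq> y0" for \<delta> y1 y2
      proof -
        have "r * norm (?G y1 y2) \<le> r * (1 / r * ?g y1 y2 x0 - 2 * \<beta> * r)"
          using suff that \<open>r > 0\<close> by (intro mult_left_mono) auto
        then have "r * norm (?G y1 y2) + 2 * \<beta> * r\<^sup>2 \<le> ?g y1 y2 x0"
          using \<open>r > 0\<close> by (simp add: right_diff_distrib power2_eq_square mult_ac)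
        moreover have "- (?G y1 y2 \<bullet> \<delta>) \<le> r * norm (?G y1 y2)"
          using norm_cauchy_schwarz[of "?G y1 y2" "- \<delta>"] that(1)
            mult_left_mono[of "norm \<delta>" r "norm (?G y1 y2)"]
          by (simp add: mult.commute)
        moreover have "2 * \<beta> * (norm \<delta>)\<^sup>2 < 2 * \<beta> * r\<^sup>2"
          using that(1) \<beta> False by (simp add: power_strict_mono)
        ultimately show ?thesis
          using bounds(2)[where x = x0 and h = \<delta> and ?y0.0 = y0 and ?y1.0 = y1 and ?y2.0 = y2]
          by linarith
      qed
      have "?M (x0 + \<delta>) = y0" if "norm \<delta> < r" for \<delta>
      proof -
        obtain c d where cd: "(c, d) \<in> {(1, 2), (2, 1)}"
          and M: "?M (x0 + \<delta>) = prediction am (f c) (x0 + \<delta>)"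
          and le: "top_margin am (f d) (x0 + \<delta>) \<le> top_margin am (f c) (x0 + \<delta>)"
          by (rule max_margin_ensemble_2E[OF \<open>argmax_rule bm\<close>])
        have "prediction am (f c) (x0 + \<delta>) = y0"
          using \<open>argmax_rule am\<close> le
        proof (rule prediction_eqI_margin_sum_pos)
          fix y1 y2
          assume "y1 \<noteq> y0" "y2 \<noteq> y0"
          \<comment> \<open>The classes swap roles when model 2 is the selected one.\<close>
          with cd pos[OF that, of y1 y2] pos[OF that, of y2 y1]
          show "0 < conf_margin (f c) y0 y1 (x0 + \<delta>) + conf_margin (f d) y0 y2 (x0 + \<delta>)"
            by (auto simp: add.commute)
        qed
        with M show ?thesis by simp
      qed
      with assms(5) show ?thesis by (simp add: robust_at_def)
    qed
  }
  {
    assume near: "\<forall>\<delta>. norm \<delta> \<le> r \<longrightarrow> (\<forall>i\<in>{1, 2}.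
        prediction am (f i) (x0 + \<delta>) = y0 \<or> runner_up am (f i) (x0 + \<delta>) = y0)"
      and robust: "robust_at r ?M x0"
    have nonneg: "0 \<le> ?g y1 y2 (x0 + \<delta>)" if "norm \<delta> < r" "y1 \<noteq> y0" "y2 \<noteq> y0" for \<delta> y1 y2
    proof -
      obtain c d where cd: "(c, d) \<in> {(1, 2), (2, 1)}"
        and M: "?M (x0 + \<delta>) = prediction am (f c) (x0 + \<delta>)"
        and le: "top_margin am (f d) (x0 + \<delta>) \<le> top_margin am (f c) (x0 + \<delta>)"
        by (rule max_margin_ensemble_2E[OF \<open>argmax_rule bm\<close>])
      have P: "prediction am (f c) (x0 + \<delta>) = y0"
        using M robust that(1) assms(5) by (simp add: robust_at_def)
      have Q: "prediction am (f d) (x0 + \<delta>) = y0 \<or> runner_up am (f d) (x0 + \<delta>) = y0"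
        using near[rule_format, of \<delta> d] that(1) cd by auto
      note * = margin_sum_nonneg[OF \<open>argmax_rule am\<close> le P Q]
      show ?thesis
        using cd *[OF that(2,3)] *[OF that(3,2)] by (auto simp: add.commute)
    qed
    show "\<forall>y1 y2. y1 \<noteq> y0 \<and> y2 \<noteq> y0 \<longrightarrow>
      norm (?G y1 y2) \<le> 1 / r * ?g y1 y2 x0 + 2 * \<beta> * r"
    proof (intro allI impI)
      fix y1 y2
      assume y: "y1 \<noteq> y0 \<and> y2 \<noteq> y0"
      have "r * norm (?G y1 y2) \<le> ?g y1 y2 x0 + 2 * \<beta> * r\<^sup>2"
      \<comment> \<open>Robustness concerns the open ball, whereas the extremal perturbation has
        length \<open>r\<close>. Perturbations of length at most \<open>z * r\<close> are used
        instead, and \<open>z\<close> tends to 1.\<close>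
      proof (rule field_le_mult_one_interval)
        fix z :: real
        assume z: "0 < z" "z < 1"
        \<comment> \<open>Steepest descent for the linearised margin sum. For a zero gradient
          \<open>sgn\<close> is 0, so \<delta> vanishes and the linear term is still the required
          one.\<close>
        define \<delta> where "\<delta> = - (z * r) *\<^sub>R sgn (?G y1 y2)"
        have zr: "0 \<le> z * r" "z * r < r" using z \<open>r > 0\<close> by simp_all
        have norm_\<delta>: "norm \<delta> \<le> z * r"
          using zr by (simp add: \<delta>_def norm_sgn)
        have "?G y1 y2 \<bullet> \<delta> = - (z * (r * norm (?G y1 y2)))"
          by (cases "?G y1 y2 = 0")
            (simp_all add: \<delta>_def sgn_div_norm dot_square_norm power2_eq_square)
        moreover have "2 * \<beta> * (norm \<delta>)\<^sup>2 \<le> 2 * \<beta> * r\<^sup>2"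
          using \<beta> norm_\<delta> zr by (intro mult_left_mono power_mono) auto
        moreover have "0 \<le> ?g y1 y2 (x0 + \<delta>)"
          using nonneg[of \<delta> y1 y2] norm_\<delta> zr y by simp
        ultimately show "z * (r * norm (?G y1 y2)) \<le> ?g y1 y2 x0 + 2 * \<beta> * r\<^sup>2"
          using bounds(1)[where x = x0 and h = \<delta> and ?y0.0 = y0 and ?y1.0 = y1 and ?y2.0 = y2]
          by linarith
      qed
      then show "norm (?G y1 y2) \<le> 1 / r * ?g y1 y2 x0 + 2 * \<beta> * r"
        using \<open>r > 0\<close> by (simp add: field_simps power2_eq_square)
    qed
  }
qed

end
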